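(* Let $l_j<u_j$ be real numbers, let $\omega,\vartheta_j\in\mathbb{R}$, let $k_j\in\{0,1,2,\ldots\}$, set $\eta_j=k_j\pi/(u_j-l_j)$, and let $$I_j(k_j,\omega):=\int_{l_j}^{u_j}\exp\!\left(i\omega\vartheta_j e^{x}\right)\cos\!\left(\frac{k_j\pi}{u_j-l_j}(x-l_j)\right)dx.$$ Then: (i) If $\omega\vartheta_j=0$, then $I_j(k_j,\omega)=0$ when $k_j\neq0$, and $I_j(k_j,\omega)=u_j-l_j$ when $k_j=0$. (ii) If $\omega\vartheta_j\neq0$ and $k_j=0$, then $$I_j(0,\omega)=\operatorname{Ei}\!\left(i\omega\vartheta_j e^{u_j}\right)-\operatorname{Ei}\!\left(i\omega\vartheta_j e^{l_j}\right).$$ (iii) If $\omega\vartheta_j\neq0$ and $k_j\neq0$, then $$I_j(k_j,\omega)=\tfrac12 I_j^{(+)}(k_j,\omega)+\tfrac12 I_j^{(-)}(k_j,\omega),\qquad I_j^{(\pm)}(k_j,\omega)=e^{\mp i\eta_j l_j}\,(-i\omega\vartheta_j)^{\mp i\eta_j}\,\gamma\!\left(\pm i\eta_j;\zeta_j^{a},\zeta_j^{b}\right),$$ where $\zeta_j^{a}=-i\omega\vartheta_j e^{l_j}$ and $\zeta_j^{b}=-i\omega\vartheta_j e^{u_j}$. Both endpoints $\zeta_j^a,\zeta_j^b$ lie on the ray from the origin of direction $-i\operatorname{sgn}(\omega\vartheta_j)$, so the segment joining them meets neither the origin nor the principal branch cut $(-\infty,0]$.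
   Context: $z^s:=\exp(s\log z)$ denotes the principal branch of the complex power (with $\log$ the principal logarithm, cut along $(-\infty,0]$). $\gamma(s;z_a,z_b):=\int_{z_a}^{z_b}t^{s-1}e^{-t}\,dt$ denotes the two-endpoint incomplete gamma integral, taken along the straight segment from $z_a$ to $z_b$, with $t^{s-1}$ the principal branch. $\operatorname{Ei}(x)=-\int_{-x}^{\infty}e^{-t}/t\,dt$ is the exponential integral, taken on its principal branch for complex arguments. Only differences of its values are used, and such a difference is the convergent integral $\operatorname{Ei}(z_b)-\operatorname{Ei}(z_a)=\int_{z_a}^{z_b}e^{t}/t\,dt$ along the straight segment joining the two points. *)

theory Defs
  imports "HOL-Complex_Analysis.Complex_Analysis"
begin

text \<open>Complex powers are the library's \<open>powr\<close>: for \<open>z \<noteq> 0\<close>, \<open>z powr s = exp (s * Ln z)\<close> with the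
  principal logarithm \<open>Ln\<close>.\<close>

definition incomplete_gamma :: "complex \<Rightarrow> complex \<Rightarrow> complex \<Rightarrow> complex" where
  "incomplete_gamma s za zb =
     contour_integral (linepath za zb) (\<lambda>t. t powr (s - 1) * exp (- t))"

text \<open>\<open>Ei x = - \<integral>\<^sub>-\<^sub>x\<^sup>\<infinity> exp (- t) / t dt\<close> for real \<open>x \<noteq> 0\<close>. For \<open>x > 0\<close> the integrand has a pole
  inside the range and the integral is a Cauchy principal value; for \<open>x < 0\<close> the removed interval
  eventually lies outside the range, so that this is the ordinary integral.\<close>

definition Ei_real :: "real \<Rightarrow> real" where
  "Ei_real x =
     - Lim (at_right 0) (\<lambda>\<epsilon>. integral ({- x..} - {- \<epsilon><..<\<epsilon>}) (\<lambda>t. exp (- t) / t))"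

text \<open>Principal branch: the continuation of \<open>Ei\<close> from the positive real axis to the plane cut along
  \<open>(-\<infinity>, 0]\<close>. That domain is star-shaped about \<open>1\<close>, so the continuation of this primitive of
  \<open>exp t / t\<close> is obtained by integrating along the segment from \<open>1\<close>. On the negative real axis,
  where the two sides of the cut differ by \<open>2 \<pi> \<i>\<close>, the value is the real one.\<close>

definition Ei :: "complex \<Rightarrow> complex" where
  "Ei z = (if z \<in> \<real> then of_real (Ei_real (Re z))
           else of_real (Ei_real 1) + contour_integral (linepath 1 z) (\<lambda>t. exp t / t))"

definition cos_integrand :: "real \<Rightarrow> real \<Rightarrow> real \<Rightarrow> nat \<Rightarrow> real \<Rightarrow> real \<Rightarrow> complex" where
  "cos_integrand l u \<theta> k \<omega> x =
     exp (\<i> * of_real \<omega> * of_real \<theta> * of_real (exp x)) *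
     of_real (cos (of_nat k * pi / (u - l) * (x - l)))"

definition cos_integral :: "real \<Rightarrow> real \<Rightarrow> real \<Rightarrow> nat \<Rightarrow> real \<Rightarrow> complex" where
  "cos_integral l u \<theta> k \<omega> = integral {l..u} (cos_integrand l u \<theta> k \<omega>)"

text \<open>\<open>integral\<close> and \<open>contour_integral\<close> return \<open>0\<close> when the integral does not exist. The following
  facts show that this default value does not occur where the integrals are used.\<close>

lemma cos_integrand_integrable: "cos_integrand l u \<theta> k \<omega> integrable_on {l..u}"
  unfolding cos_integrand_def by (intro integrable_continuous_interval continuous_intros)

lemma incomplete_gamma_integrable:
  assumes "closed_segment za zb \<inter> \<real>\<^sub>\<le>\<^sub>0 = {}"
  shows "(\<lambda>t. t powr (s - 1) * exp (- t)) contour_integrable_on linepath za zb"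
proof (rule contour_integrable_continuous_linepath)
  have "t \<notin> \<real>\<^sub>\<le>\<^sub>0" if "t \<in> closed_segment za zb" for t
    using assms that by auto
  then show "continuous_on (closed_segment za zb) (\<lambda>t. t powr (s - 1) * exp (- t))"
    by (intro continuous_intros) (force simp: complex_nonpos_Reals_iff)+
qed

lemma Ei_integrable:
  assumes "0 \<notin> closed_segment za zb"
  shows "(\<lambda>t. exp t / t) contour_integrable_on linepath za zb"
  using assms by (intro contour_integrable_continuous_linepath continuous_intros) auto

end

theory Submission
  imports Defs
begin

text \<open>The substitution \<open>t = c * exp x\<close> turns \<open>dx\<close> into \<open>dt / t\<close> and maps \<open>[l, u]\<close> onto a segment of an
  open half-plane on which the integrand has a primitive, so both sides are the same increment of
  that primitive. For \<open>k = 0\<close> the transformed integrand is \<open>exp t / t\<close>; for \<open>k \<noteq> 0\<close> the cosine is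
  split into two exponentials, and \<open>exp (s * x)\<close> becomes \<open>c powr (- s) * t powr s\<close>, since
  \<open>Ln (c * exp x) = Ln c + x\<close>.\<close>

text \<open>Convexity of \<open>S\<close> serves twice: it gives \<open>f\<close> a primitive on
  \<open>S\<close>, and it keeps the straight segment between the endpoints inside \<open>S\<close>.
  The factor \<open>c * of_real (exp x)\<close> is the derivative of the substitution.\<close>

lemma has_integral_exp_substitution:
  fixes c :: complex
  assumes "l \<le> u" "convex S" "open S" "f holomorphic_on S"
    and mem: "\<And>x. x \<in> {l..u} \<Longrightarrow> c * of_real (exp x) \<in> S"
  shows "((\<lambda>x. f (c * of_real (exp x)) * (c * of_real (exp x))) has_integral
           contour_integral (linepath (c * of_real (exp l)) (c * of_real (exp u))) f) {l..u}"
proof -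
  obtain g where g: "\<And>z. z \<in> S \<Longrightarrow> (g has_field_derivative f z) (at z within S)"
    using holomorphic_convex_primitive'[OF assms(2-4)] by blast
  let ?h = "\<lambda>x. c * of_real (exp x)"
  have "(f has_contour_integral (g (pathfinish (linepath (?h l) (?h u))) -
          g (pathstart (linepath (?h l) (?h u))))) (linepath (?h l) (?h u))"
    using mem[of l] mem[of u] \<open>l \<le> u\<close> \<open>convex S\<close>
    by (intro contour_integral_primitive[OF g]) (auto simp: closed_segment_subset subsetD)
  then have "contour_integral (linepath (?h l) (?h u)) f = g (?h u) - g (?h l)"
    by (simp add: contour_integral_unique)
  moreover have "((\<lambda>x. ?h x * f (?h x)) has_integral ((g \<circ> ?h) u - (g \<circ> ?h) l)) {l..u}"
  proof (rule fundamental_theorem_of_calculus[OF \<open>l \<le> u\<close>])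
    fix x assume x: "x \<in> {l..u}"
    have "(?h has_vector_derivative ?h x) (at x within {l..u})"
      by (auto intro!: derivative_eq_intros)
    moreover have "(g has_field_derivative f (?h x)) (at (?h x) within ?h ` {l..u})"
      using g[OF mem[OF x]] by (rule DERIV_subset) (use mem in auto)
    ultimately show "((g \<circ> ?h) has_vector_derivative ?h x * f (?h x)) (at x within {l..u})"
      by (rule field_vector_diff_chain_within)
  qed
  ultimately show ?thesis
    by (simp add: mult.commute)
qed

lemma incomplete_gamma_has_integral:
  fixes c s :: complex
  assumes "l \<le> u" "Im c \<noteq> 0"
  shows "((\<lambda>x. exp (- (c * of_real (exp x))) * exp (s * of_real x)) has_integral
           c powr (- s) * incomplete_gamma s (c * of_real (exp l)) (c * of_real (exp u))) {l..u}"
proof -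
  have c: "c \<noteq> 0" using assms by auto
  \<comment> \<open>The condition reads \<open>Im c * Im z > 0\<close>, so this is the open upper or
    lower half-plane that contains \<open>c\<close>. It misses the whole real axis, hence the cut of
    \<open>powr\<close>.\<close>
  define S where "S = {z. (Im c *\<^sub>R \<i>) \<bullet> z > 0}"
  have "convex S" "open S"
    unfolding S_def by (simp_all add: convex_halfspace_gt open_halfspace_gt del: inner_scaleR_left)
  moreover have "(\<lambda>t. t powr (s - 1) * exp (- t)) holomorphic_on S"
    by (intro holomorphic_intros) (auto simp: S_def complex_nonpos_Reals_iff)
  moreover have "c * of_real (exp x) \<in> S" for x
    using assms by (auto simp: S_def zero_less_mult_iff mult_less_0_iff linorder_neq_iff)
  ultimately have "((\<lambda>x. (c * of_real (exp x)) powr (s - 1) * exp (- (c * of_real (exp x))) *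
      (c * of_real (exp x))) has_integral
      incomplete_gamma s (c * of_real (exp l)) (c * of_real (exp u))) {l..u}"
    unfolding incomplete_gamma_def by (intro has_integral_exp_substitution[OF \<open>l \<le> u\<close>])
  then have "((\<lambda>x. c powr (- s) * ((c * of_real (exp x)) powr (s - 1) *
      exp (- (c * of_real (exp x))) * (c * of_real (exp x)))) has_integral
      c powr (- s) * incomplete_gamma s (c * of_real (exp l)) (c * of_real (exp u))) {l..u}"
    by (rule has_integral_mult_right)
  moreover have "c powr (- s) * ((c * of_real (exp x)) powr (s - 1) *
      exp (- (c * of_real (exp x))) * (c * of_real (exp x))) =
      exp (- (c * of_real (exp x))) * exp (s * of_real x)" for x :: real
  proof -
    \<comment> \<open>A positive real factor leaves the argument unchanged, so no multiple of
      \<open>2 * pi * \<i>\<close> enters and the power splits exactly.\<close>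
    have ln: "Ln (c * of_real (exp x)) = Ln c + of_real x"
      using c Ln_times_of_real[of "exp x" c] by (simp add: Ln_of_real mult.commute)
    have "(c * of_real (exp x)) powr (s - 1) * (c * of_real (exp x)) = (c * of_real (exp x)) powr s"
      using c by (simp add: powr_diff)
    also have "\<dots> = exp (s * Ln c) * exp (s * of_real x)"
      using c ln by (simp add: powr_def ring_distribs exp_add)
    finally have "(c * of_real (exp x)) powr (s - 1) * (c * of_real (exp x)) =
      exp (s * Ln c) * exp (s * of_real x)" .
    moreover have "c powr (- s) * exp (s * Ln c) = 1"
      using c by (simp add: powr_def flip: exp_add)
    moreover have "a * (b * e * w) = e * q" if "b * w = p * q" "a * p = 1" for a b e w p q :: complex
      using that by (metis mult.assoc mult.commute mult.right_neutral)
    ultimately show ?thesis by blast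
  qed
  ultimately show ?thesis by simp
qed

text \<open>\<open>Ei\<close> integrates along segments from \<open>1\<close>, so the difference
  compares the path from \<open>za\<close> via \<open>1\<close> to \<open>zb\<close> with the direct
  segment. A primitive of \<open>exp t / t\<close> on a convex set containing all three points but
  not \<open>0\<close> makes the two agree.\<close>

lemma Ei_diff:
  assumes "Im za * Im zb > 0"
  shows "Ei zb - Ei za = contour_integral (linepath za zb) (\<lambda>t. exp t / t)"
proof -
  text \<open>This half-plane contains \<open>za\<close>, \<open>zb\<close> and the base point \<open>1\<close> of \<open>Ei\<close>.\<close>
  define \<sigma> where "\<sigma> = (1 + \<bar>Re za / Im za\<bar> + \<bar>Re zb / Im zb\<bar>) * sgn (Im za)"
  define S where "S = {z. Complex 1 \<sigma> \<bullet> z > 0}"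
  have S: "convex S" "open S"
    unfolding S_def by (simp_all add: convex_halfspace_gt open_halfspace_gt)
  \<comment> \<open>The left side is \<open>Complex 1 \<sigma> \<bullet> z\<close>. As \<sigma> has
    the sign of \<open>Im z\<close>, its second term is positive, and the summand \<open>1\<close>
    in \<sigma> makes it exceed \<open>\<bar>Re z\<bar>\<close>.\<close>
  have *: "Re z + \<sigma> * Im z > 0"
    if "Im z * Im za > 0" "\<bar>Re z / Im z\<bar> \<le> \<bar>Re za / Im za\<bar> + \<bar>Re zb / Im zb\<bar>" for z
  proof -
    have z: "sgn (Im za) * Im z = \<bar>Im z\<bar>" "Im z \<noteq> 0"
      using that(1) by (auto simp: sgn_if zero_less_mult_iff)
    have "\<bar>Re z\<bar> = \<bar>Re z / Im z\<bar> * \<bar>Im z\<bar>"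
      using z by (simp add: abs_divide)
    also have "\<dots> < (1 + \<bar>Re za / Im za\<bar> + \<bar>Re zb / Im zb\<bar>) * \<bar>Im z\<bar>"
      using that(2) z(2) by (intro mult_strict_right_mono) auto
    also have "\<dots> = \<sigma> * Im z"
      unfolding \<sigma>_def z(1)[symmetric] by (simp add: mult.assoc)
    finally show ?thesis by linarith
  qed
  have mem: "1 \<in> S" "za \<in> S" "zb \<in> S"
    using assms *[of za] *[of zb]
    by (auto simp: S_def inner_complex_def mult.commute zero_less_mult_iff)
  have "(\<lambda>t. exp t / t) holomorphic_on S"
    by (intro holomorphic_intros) (auto simp: S_def)
  with S obtain g where g: "\<And>z. z \<in> S \<Longrightarrow> (g has_field_derivative exp z / z) (at z within S)"
    using holomorphic_convex_primitive' by blast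
  have seg: "contour_integral (linepath a b) (\<lambda>t. exp t / t) = g b - g a" if "a \<in> S" "b \<in> S" for a b
    using contour_integral_primitive[OF g, of "linepath a b"] that S(1)
    by (auto simp: closed_segment_subset intro!: contour_integral_unique)
  \<comment> \<open>Both values of \<open>Ei\<close> thus come from the contour branch of its
    definition, and the constant \<open>Ei_real 1\<close> cancels.\<close>
  have "za \<notin> \<real>" "zb \<notin> \<real>"
    using assms by (auto simp: complex_is_Real_iff)
  then show ?thesis
    by (simp add: Ei_def seg mem)
qed

text \<open>Positive multiples of \<open>c\<close> are closed under convex combinations. This
  carries what is known of a ray over to the whole segment, to keep it away from \<open>0\<close>
  and from the cut.\<close>

lemma closed_segment_positive_multiples:
  fixes c :: "'a :: real_vector"
  assumes "0 < a" "0 < b" "z \<in> closed_segment (a *\<^sub>R c) (b *\<^sub>R c)"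
  obtains r where "0 < r" "z = r *\<^sub>R c"
proof -
  obtain t where t: "0 \<le> t" "t \<le> 1" "z = (1 - t) *\<^sub>R a *\<^sub>R c + t *\<^sub>R b *\<^sub>R c"
    using assms(3) by (auto simp: in_segment)
  have "(1 - t) * a + t * b > 0"
    using t(1,2) assms(1,2)
    by (cases "t = 0") (auto intro!: add_nonneg_pos)
  with t(3) show thesis
    by (intro that[of "(1 - t) * a + t * b"]) (simp_all add: scaleR_left_distrib)
qed

theorem theorem6p2:
  fixes l u \<omega> \<theta> \<eta> :: real and k :: nat and \<zeta>a \<zeta>b :: complex
  assumes "l < u"
    and "\<eta> = of_nat k * pi / (u - l)"
    and "\<zeta>a = - \<i> * of_real \<omega> * of_real \<theta> * of_real (exp l)"
    and "\<zeta>b = - \<i> * of_real \<omega> * of_real \<theta> * of_real (exp u)"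
  shows
    "(\<omega> * \<theta> = 0 \<longrightarrow>
        (k \<noteq> 0 \<longrightarrow> cos_integral l u \<theta> k \<omega> = 0) \<and>
        (k = 0 \<longrightarrow> cos_integral l u \<theta> k \<omega> = of_real (u - l)))
     \<and>
     (\<omega> * \<theta> \<noteq> 0 \<and> k = 0 \<longrightarrow>
        (let za = \<i> * of_real \<omega> * of_real \<theta> * of_real (exp l);
             zb = \<i> * of_real \<omega> * of_real \<theta> * of_real (exp u)
         in cos_integral l u \<theta> 0 \<omega> = Ei zb - Ei za \<and>
            0 \<notin> closed_segment za zb \<and>
            Ei zb - Ei za = contour_integral (linepath za zb) (\<lambda>t. exp t / t)))
     \<and>
     (\<omega> * \<theta> \<noteq> 0 \<and> k \<noteq> 0 \<longrightarrow>
        (let I_plus = exp (- \<i> * of_real \<eta> * of_real l) *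
               (- \<i> * of_real \<omega> * of_real \<theta>) powr (- \<i> * of_real \<eta>) *
               incomplete_gamma (\<i> * of_real \<eta>) \<zeta>a \<zeta>b;
             I_minus = exp (\<i> * of_real \<eta> * of_real l) *
               (- \<i> * of_real \<omega> * of_real \<theta>) powr (\<i> * of_real \<eta>) *
               incomplete_gamma (- \<i> * of_real \<eta>) \<zeta>a \<zeta>b
         in cos_integral l u \<theta> k \<omega> = 1 / 2 * I_plus + 1 / 2 * I_minus) \<and>
        (\<exists>r>0. \<zeta>a = of_real r * (- \<i> * of_real (sgn (\<omega> * \<theta>)))) \<and>
        (\<exists>r>0. \<zeta>b = of_real r * (- \<i> * of_real (sgn (\<omega> * \<theta>)))) \<and>
        0 \<notin> closed_segment \<zeta>a \<zeta>b \<and>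
        closed_segment \<zeta>a \<zeta>b \<inter> \<real>\<^sub>\<le>\<^sub>0 = {})"
proof -
  have "u - l > 0" using assms(1) by simp
  have zero: "cos_integral l u \<theta> k \<omega> = (if k = 0 then of_real (u - l) else 0)" if "\<omega> * \<theta> = 0"
  proof (cases "k = 0")
    case True
    have "cos_integrand l u \<theta> k \<omega> = (\<lambda>_. 1)"
      using that True by (auto simp: cos_integrand_def)
    then show ?thesis
      using True \<open>u - l > 0\<close> by (simp add: cos_integral_def scaleR_conv_of_real)
  next
    case False
    then have \<eta>: "\<eta> \<noteq> 0" using assms by auto
    have "((\<lambda>x. cos (\<eta> * (x - l))) has_integral
            (sin (\<eta> * (u - l)) / \<eta> - sin (\<eta> * (l - l)) / \<eta>)) {l..u}"
      using assms(1) \<eta>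
      by (intro fundamental_theorem_of_calculus)
        (auto intro!: derivative_eq_intros simp flip: has_real_derivative_iff_has_vector_derivative)
    \<comment> \<open>The interval holds a whole number of half periods, so the sine primitive
      vanishes at both ends.\<close>
    moreover have "\<eta> * (u - l) = of_nat k * pi"
      using \<open>u - l > 0\<close> by (simp add: assms(2))
    ultimately have "((\<lambda>x. cos (\<eta> * (x - l))) has_integral 0) {l..u}"
      by simp
    then have "((\<lambda>x. complex_of_real (cos (\<eta> * (x - l)))) has_integral of_real 0) {l..u}"
      by (rule has_integral_of_real)
    moreover have "cos_integrand l u \<theta> k \<omega> = (\<lambda>x. of_real (cos (\<eta> * (x - l))))"
      using that by (auto simp: cos_integrand_def assms(2))
    ultimately show ?thesis
      using False by (simp add: cos_integral_def integral_unique)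
  qed
  have Ei: "cos_integral l u \<theta> 0 \<omega> = Ei (c * of_real (exp u)) - Ei (c * of_real (exp l)) \<and>
      0 \<notin> closed_segment (c * of_real (exp l)) (c * of_real (exp u)) \<and>
      Ei (c * of_real (exp u)) - Ei (c * of_real (exp l)) =
        contour_integral (linepath (c * of_real (exp l)) (c * of_real (exp u))) (\<lambda>t. exp t / t)"
    if nz: "\<omega> * \<theta> \<noteq> 0" and c_def: "c = \<i> * of_real \<omega> * of_real \<theta>" for c
  proof -
    have c: "Im c = \<omega> * \<theta>" "c \<noteq> 0" using nz by (auto simp: c_def)
    \<comment> \<open>The integrand has a pole at \<open>0\<close> but no cut, so the half-plane
      with normal \<open>c\<close> suffices: it contains the ray through \<open>c\<close> and omits
      \<open>0\<close>.\<close>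
    define S where "S = {z. c \<bullet> z > 0}"
    have "convex S" "open S"
      unfolding S_def by (simp_all add: convex_halfspace_gt open_halfspace_gt)
    moreover have "(\<lambda>t. exp t / t) holomorphic_on S"
      by (intro holomorphic_intros) (auto simp: S_def)
    moreover have "c * of_real (exp x) \<in> S" for x
      using c(2) by (simp add: S_def mult.commute[of c] flip: scaleR_conv_of_real)
    ultimately have "((\<lambda>x. exp (c * of_real (exp x)) / (c * of_real (exp x)) * (c * of_real (exp x)))
      has_integral contour_integral (linepath (c * of_real (exp l)) (c * of_real (exp u)))
        (\<lambda>t. exp t / t)) {l..u}"
      using assms(1) by (intro has_integral_exp_substitution) auto
    moreover have "(\<lambda>x. exp (c * of_real (exp x)) / (c * of_real (exp x)) * (c * of_real (exp x))) =
      cos_integrand l u \<theta> 0 \<omega>"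
      using c(2) by (auto simp: cos_integrand_def c_def)
    ultimately have "cos_integral l u \<theta> 0 \<omega> =
      contour_integral (linepath (c * of_real (exp l)) (c * of_real (exp u))) (\<lambda>t. exp t / t)"
      by (simp add: cos_integral_def integral_unique)
    \<comment> \<open>These factors are the imaginary parts of the endpoints; their common sign is
      the hypothesis of \<open>Ei_diff\<close>.\<close>
    moreover have "(\<omega> * \<theta> * exp l) * (\<omega> * \<theta> * exp u) > 0"
      using nz by (auto simp: zero_less_mult_iff mult_less_0_iff linorder_neq_iff)
    then have "Im (c * of_real (exp l)) * Im (c * of_real (exp u)) > 0"
      by (simp add: c(1) del: of_real_exp)
    note Ei_diff[OF this]
    moreover have "0 \<notin> closed_segment (exp l *\<^sub>R c) (exp u *\<^sub>R c)"
      using c(2) by (auto elim!: closed_segment_positive_multiples[rotated 2])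
    ultimately show ?thesis
      by (simp add: scaleR_conv_of_real mult.commute)
  qed
  have gamma: "cos_integral l u \<theta> k \<omega> =
      1 / 2 * (exp (- \<i> * of_real \<eta> * of_real l) * c powr (- \<i> * of_real \<eta>) *
        incomplete_gamma (\<i> * of_real \<eta>) \<zeta>a \<zeta>b) +
      1 / 2 * (exp (\<i> * of_real \<eta> * of_real l) * c powr (\<i> * of_real \<eta>) *
        incomplete_gamma (- \<i> * of_real \<eta>) \<zeta>a \<zeta>b)"
    if nz: "\<omega> * \<theta> \<noteq> 0" and c_def: "c = - \<i> * of_real \<omega> * of_real \<theta>" for c
  proof -
    have Im: "Im c \<noteq> 0" using nz by (simp add: c_def)
    have \<zeta>: "\<zeta>a = c * of_real (exp l)" "\<zeta>b = c * of_real (exp u)"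
      using assms(3,4) c_def by auto
    define s where "s = \<i> * complex_of_real \<eta>"
    \<comment> \<open>With \<open>c\<close> chosen so that \<open>exp (- t)\<close> becomes the
      oscillating factor, \<open>?F s\<close> is that factor times half of
      \<open>exp (s * (x - l))\<close>. The exponents \<open>s\<close> and \<open>- s\<close> give
      the two halves of the cosine.\<close>
    let ?F = "\<lambda>s x. 1 / 2 * (exp (- s * of_real l) *
      (exp (- (c * of_real (exp x))) * exp (s * of_real x)))"
    let ?J = "\<lambda>s. 1 / 2 * (exp (- s * of_real l) * (c powr (- s) * incomplete_gamma s \<zeta>a \<zeta>b))"
    \<comment> \<open>Here \<open>s\<close> is bound afresh, so the fact serves both signs of the
      exponent.\<close>
    have "(?F s has_integral ?J s) {l..u}" for s
      unfolding \<zeta> using assms(1) Im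
      by (intro has_integral_mult_right incomplete_gamma_has_integral) auto
    then have "((\<lambda>x. ?F s x + ?F (- s) x) has_integral (?J s + ?J (- s))) {l..u}"
      by (intro has_integral_add)
    moreover have "?F s x + ?F (- s) x = cos_integrand l u \<theta> k \<omega> x" for x
    proof -
      have alg: "1 / 2 * (a * (e * b)) + 1 / 2 * (a' * (e * b')) = e * ((a * b + a' * b') / 2)"
        for a b a' b' e :: complex
        by (simp add: distrib_left add_divide_distrib mult_ac)
      have "complex_of_real (cos (\<eta> * (x - l))) =
        (exp (s * (of_real x - of_real l)) + exp (- (s * (of_real x - of_real l)))) / 2"
        by (simp add: s_def cos_exp_eq mult.assoc flip: cos_of_real)
      also have "\<dots> = (exp (- s * of_real l) * exp (s * of_real x) +
          exp (- (- s) * of_real l) * exp (- s * of_real x)) / 2"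
        by (simp add: algebra_simps flip: exp_add)
      finally show ?thesis
        unfolding alg by (simp add: cos_integrand_def c_def flip: assms(2))
    qed
    ultimately have "cos_integral l u \<theta> k \<omega> = ?J s + ?J (- s)"
      by (simp add: cos_integral_def integral_unique)
    then show ?thesis
      by (simp add: s_def mult.assoc)
  qed
  have ray: "(\<exists>r>0. \<zeta>a = of_real r * d) \<and> (\<exists>r>0. \<zeta>b = of_real r * d) \<and>
      0 \<notin> closed_segment \<zeta>a \<zeta>b \<and> closed_segment \<zeta>a \<zeta>b \<inter> \<real>\<^sub>\<le>\<^sub>0 = {}"
    if nz: "\<omega> * \<theta> \<noteq> 0" and d: "d = - \<i> * of_real (sgn (\<omega> * \<theta>))" for d
  proof -
    have "- \<i> * of_real \<omega> * of_real \<theta> * of_real r = (\<bar>\<omega> * \<theta>\<bar> * r) *\<^sub>R d" for r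
    proof -
      have "complex_of_real (\<omega> * \<theta>) = of_real \<bar>\<omega> * \<theta>\<bar> * of_real (sgn (\<omega> * \<theta>))"
        by (simp only: abs_mult_sgn flip: of_real_mult)
      then show ?thesis
        by (simp only: d scaleR_conv_of_real of_real_mult) (simp add: mult_ac)
    qed
    then have \<zeta>: "\<zeta>a = (\<bar>\<omega> * \<theta>\<bar> * exp l) *\<^sub>R d" "\<zeta>b = (\<bar>\<omega> * \<theta>\<bar> * exp u) *\<^sub>R d"
      by (simp_all only: assms(3,4))
    have pos: "\<bar>\<omega> * \<theta>\<bar> * exp l > 0" "\<bar>\<omega> * \<theta>\<bar> * exp u > 0"
      using nz by simp_all
    have "z \<notin> \<real>\<^sub>\<le>\<^sub>0" if z: "z \<in> closed_segment \<zeta>a \<zeta>b" for z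
    proof -
      obtain r where "r > 0" "z = r *\<^sub>R d"
        using closed_segment_positive_multiples[OF pos] z unfolding \<zeta> by blast
      \<comment> \<open>\<open>d\<close> is \<open>\<i>\<close> or \<open>- \<i>\<close>, so
        \<open>z\<close> has imaginary part \<open>r\<close> or \<open>- r\<close> and is not
        real.\<close>
      then show ?thesis using nz by (auto simp: d complex_nonpos_Reals_iff sgn_if)
    qed
    moreover from this have "0 \<notin> closed_segment \<zeta>a \<zeta>b"
      by fastforce
    moreover have "\<exists>r>0. \<zeta>a = of_real r * d" "\<exists>r>0. \<zeta>b = of_real r * d"
      using \<zeta> pos by (metis scaleR_conv_of_real)+
    ultimately show ?thesis
      by auto
  qed
  show ?thesis
    unfolding Let_def
  proof (intro conjI[OF _ conjI] impI)
    assume "\<omega> * \<theta> = 0"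
    from zero[OF this] show "(k \<noteq> 0 \<longrightarrow> cos_integral l u \<theta> k \<omega> = 0) \<and>
        (k = 0 \<longrightarrow> cos_integral l u \<theta> k \<omega> = of_real (u - l))"
      by auto
  qed (use Ei[OF _ refl] gamma[OF _ refl] ray[OF _ refl] in blast)+
qed

end
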